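(* Let $n\ge 2$ and let $\mathcal{S}_n$ be the set of integer solutions, identified up to permutation of coordinates, of $\left(\sum_i x_i\right)^2-\sum_i x_i-4\sum_{1\le i<j\le n}x_ix_j=0$, with two elements adjacent if (for suitable orderings) they differ in exactly one coordinate. Define the height of $\mathbf{a}$ as $\left|1+\sum_i a_i\right|$, and call a vertex a root if all its neighbors have greater height. Then every connected component of $\mathcal{S}_n$ is a tree containing exactly one root (namely its unique vertex of minimal height). *)

theory Defs
  imports "Graph_Theory.Graph_Theory" "HOL-Library.Multiset"
begin

definition solves :: "nat \<Rightarrow> int list \<Rightarrow> bool" where
  "solves n xs \<longleftrightarrow> length xs = n \<and>
     (\<Sum>i<n. xs ! i)\<^sup>2 - (\<Sum>i<n. xs ! i)
       - 4 * (\<Sum>(i, j) \<in> {(i, j). i < j \<and> j < n}. xs ! i * xs ! j) = 0"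

text \<open>A multiset of integers is an integer vector up to permutation of coordinates.\<close>

definition solution_set :: "nat \<Rightarrow> int multiset set" where
  "solution_set n = mset ` {xs. solves n xs}"

definition adjacent :: "nat \<Rightarrow> int multiset \<Rightarrow> int multiset \<Rightarrow> bool" where
  "adjacent n A B \<longleftrightarrow>
     (\<exists>xs ys. length xs = n \<and> length ys = n \<and> mset xs = A \<and> mset ys = B \<and>
        (\<exists>!i. i < n \<and> xs ! i \<noteq> ys ! i))"

text \<open>An undirected edge is represented by a pair of opposite arcs.\<close>

definition solution_graph :: "nat \<Rightarrow> (int multiset, int multiset \<times> int multiset) pre_digraph" where
  "solution_graph n = with_proj
     \<lparr> pverts = solution_set n,
       parcs = {(A, B). A \<in> solution_set n \<and> B \<in> solution_set n \<and> adjacent n A B} \<rparr>"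

definition height :: "int multiset \<Rightarrow> int" where
  "height A = \<bar>1 + sum_mset A\<bar>"

definition is_root :: "nat \<Rightarrow> int multiset \<Rightarrow> bool" where
  "is_root n A \<longleftrightarrow> A \<in> verts (solution_graph n) \<and>
     (\<forall>B. A \<rightarrow>\<^bsub>solution_graph n\<^esub> B \<longrightarrow> height A < height B)"

definition connected_component ::
  "('a, 'b) pre_digraph \<Rightarrow> ('a, 'b) pre_digraph \<Rightarrow> bool" where
  "connected_component G C \<longleftrightarrow> pre_digraph.max_subgraph G connected C"

text \<open>
  The library predicate \<^const>\<open>tree\<close> counts the walk \<open>u, v, u\<close> as a cycle, so it excludes every
  symmetric digraph with an edge. For a simple undirected graph, represented as a symmetric
  digraph without loops and parallel arcs, the cycles are those of length at least 3.
\<close>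

definition undirected_tree :: "('a, 'b) pre_digraph \<Rightarrow> bool" where
  "undirected_tree G \<longleftrightarrow>
     sym_digraph G \<and> loopfree_digraph G \<and> nomulti_digraph G \<and> connected G \<and>
     \<not> (\<exists>p. pre_digraph.cycle G p \<and> length p \<ge> 3)"

end

theory Submission
  imports Defs
begin

text \<open>
  Since \<open>2 * (\<Sum>i<j. x\<^sub>i * x\<^sub>j) = s\<^sup>2 - (\<Sum>i. x\<^sub>i\<^sup>2)\<close> with \<open>s = \<Sum>i. x\<^sub>i\<close>, the equation reads
  \<open>2 * (\<Sum>i. x\<^sub>i\<^sup>2) = s * (s + 1)\<close>. It is quadratic in each coordinate \<open>x\<close>, and the other root is
  \<open>2 * t + 1 - x\<close>, where \<open>t\<close> is the sum of the remaining coordinates. By parity the heights of two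
  neighbours differ. Passing to the other root lowers the height only if
  \<open>s \<ge> 1\<close> and \<open>2 * x \<ge> s + 1\<close>, or \<open>s \<le> - 2\<close> and \<open>2 * x \<le> s\<close>; two such coordinates would make the
  left-hand side exceed \<open>s * (s + 1)\<close>. So each vertex has at most one lower neighbour. A highest
  vertex of a cycle would have two, and descending from any vertex of a component must end in the
  same root.
\<close>

section \<open>Graphs with a unique descent\<close>

text \<open>The two facts about heights on which the graph argument rests. \<open>h\<close> takes
  natural values so that a lowest vertex exists; it becomes \<open>nat (height A)\<close> on a
  single component.\<close>

locale unique_descent_graph = sym_digraph G for G (structure) +
  fixes h :: "'a \<Rightarrow> nat"
  assumes adj_height_neq: "u \<rightarrow>\<^bsub>G\<^esub> v \<Longrightarrow> h u \<noteq> h v"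
    and lower_unique: "u \<rightarrow>\<^bsub>G\<^esub> v \<Longrightarrow> u \<rightarrow>\<^bsub>G\<^esub> w \<Longrightarrow> h v < h u \<Longrightarrow> h w < h u \<Longrightarrow> v = w"
begin

definition local_min :: "'a \<Rightarrow> bool" where
  "local_min r \<longleftrightarrow> r \<in> verts G \<and> (\<forall>v. r \<rightarrow>\<^bsub>G\<^esub> v \<longrightarrow> h r < h v)"

definition descent :: "('a \<times> 'a) set" where
  "descent = {(u, v). u \<rightarrow>\<^bsub>G\<^esub> v \<and> h v < h u}"

lemma descent_rtrancl_less: "(u, v) \<in> descent\<^sup>* \<Longrightarrow> u = v \<or> h v < h u"
  by (induction rule: rtrancl_induct) (auto simp: descent_def)

text \<open>Induction along a walk from \<open>r\<close>. An upward step prepends an arc to the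
  descent; a downward step from \<open>x\<close> must follow the first arc of its descent, since
  only one neighbour is lower, and leaves the remainder.\<close>

lemma reachable_imp_descent:
  assumes "local_min r" and "r \<rightarrow>\<^sup>* v"
  shows "(v, r) \<in> descent\<^sup>*"
  using assms(2)
proof (induction rule: reachable_induct)
  case base
  show ?case by simp
next
  case (step x y)
  have yx: "y \<rightarrow>\<^bsub>G\<^esub> x"
    using step.hyps(2) by (rule graph_symmetric)
  show ?case
  proof (cases "h x < h y")
    case True
    with yx have "(y, x) \<in> descent" by (simp add: descent_def)
    then show ?thesis using step.IH by (rule converse_rtrancl_into_rtrancl)
  next
    case False
    with adj_height_neq[OF yx] have lt: "h y < h x" by simp
    \<comment> \<open>A local minimum has no lower neighbour, whereas \<open>x\<close> has
      \<open>y\<close>; so the descent from \<open>x\<close> is not empty.\<close>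
    then have "x \<noteq> r"
      using assms(1) step.hyps(2) unfolding local_min_def by fastforce
    then obtain z where z: "(x, z) \<in> descent" "(z, r) \<in> descent\<^sup>*"
      using step.IH by (metis converse_rtranclE)
    then have "z = y"
      using lower_unique[OF _ step.hyps(2) _ lt] by (simp add: descent_def)
    with z show ?thesis by simp
  qed
qed

lemma local_min_strict:
  assumes "connected G" "local_min r" "v \<in> verts G" "v \<noteq> r"
  shows "h r < h v"
proof -
  have "r \<rightarrow>\<^sup>* v"
    using symmetric_connected_imp_strongly_connected[OF sym_arcs assms(1)] assms(2,3)
    by (auto simp: strongly_connected_def local_min_def)
  then show ?thesis
    using descent_rtrancl_less[OF reachable_imp_descent[OF assms(2)]] assms(4) by blast
qed

text \<open>A lowest vertex is a local minimum because adjacent heights differ. A second local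
  minimum would lie strictly below it.\<close>

lemma ex1_local_min:
  assumes "connected G"
  shows "\<exists>!r. local_min r"
proof -
  have "verts G \<noteq> {}"
    using assms by (simp add: connected_conv)
  then obtain r where r: "r \<in> verts G" "\<And>v. v \<in> verts G \<Longrightarrow> h r \<le> h v"
    using ex_has_least_nat[of "\<lambda>v. v \<in> verts G" _ h] by blast
  have "local_min r"
    unfolding local_min_def
    using r adj_height_neq adj_in_verts(2) by (metis le_neq_implies_less)
  moreover have "r' = r" if "local_min r'" for r'
    using local_min_strict[OF assms that r(1)] r(2)[of r'] that
    by (fastforce simp: local_min_def)
  ultimately show ?thesis by blast
qed

text \<open>Both neighbours of a highest vertex along a cycle are lower, hence equal by
  \<open>lower_unique\<close>; on a cycle of length at least 3 they are distinct.\<close>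

lemma short_cycle:
  assumes "cycle p"
  shows "length p < 3"
proof (rule ccontr)
  assume "\<not> length p < 3"
  define m where "m = length p"
  have m: "3 \<le> m" and ne: "p \<noteq> []" using \<open>\<not> length p < 3\<close> by (auto simp: m_def)
  from assms obtain u where u: "awalk u p u" "distinct (tl (awalk_verts u p))"
    by (auto simp: cycle_def)
  then have cas: "cas u p u" and arcs: "set p \<subseteq> arcs G" by (auto simp: awalk_def)
  \<comment> \<open>Two readings of the vertex list, by heads and by tails; comparing them shows
    that each arc starts where the previous one ends.\<close>
  have verts: "awalk_verts u p = tail G (hd p) # map (head G) p"
    "awalk_verts u p = map (tail G) p @ [head G (last p)]"
    using awalk_verts_conv'[OF cas] ne by (simp_all add: awalk_verts_conv)
  have last: "head G (last p) = u" and hd: "tail G (hd p) = u"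
    using awlast_of_awalk[OF u(1)] verts(2) cas ne by (simp_all add: cas_simp)
  have distinct: "distinct (map (head G) p)"
    using u(2) verts(1) by simp
  have inj: "i = j" if "i < m" "j < m" "head G (p ! i) = head G (p ! j)" for i j
    using distinct that by (simp add: distinct_conv_nth m_def) blast
  have tail_Suc: "tail G (p ! Suc i) = head G (p ! i)" if "Suc i < m" for i
  proof -
    have "awalk_verts u p ! Suc i = tail G (p ! Suc i)"
      using that by (simp add: verts(2) nth_append m_def)
    moreover have "awalk_verts u p ! Suc i = head G (p ! i)"
      using that by (simp add: verts(1) m_def)
    ultimately show ?thesis by simp
  qed
  have tail_0: "tail G (p ! 0) = head G (p ! (m - 1))"
    using hd last ne by (simp add: hd_conv_nth last_conv_nth m_def)
  define prv where "prv i = (if i = 0 then m - 1 else i - 1)" for i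
  define nxt where "nxt i = (if i = m - 1 then 0 else Suc i)" for i
  have tail_prv: "tail G (p ! i) = head G (p ! prv i)" if "i < m" for i
    using that tail_0 tail_Suc[of "i - 1"] by (auto simp: prv_def)
  obtain k where k: "k < m" "\<And>i. i < m \<Longrightarrow> h (head G (p ! i)) \<le> h (head G (p ! k))"
  proof -
    let ?f = "\<lambda>i. h (head G (p ! i))"
    have "Max (?f ` {..<m}) \<in> ?f ` {..<m}"
      using m by (intro Max_in) (auto simp: lessThan_empty_iff)
    then obtain k where "k < m" "?f k = Max (?f ` {..<m})" by auto
    then show thesis
      using that[of k] by simp
  qed
  \<comment> \<open>For a cycle of length 2 the indices \<open>prv k\<close> and
    \<open>nxt k\<close> would coincide.\<close>
  have idx: "prv k < m" "nxt k < m" "prv k \<noteq> nxt k" "prv (nxt k) = k"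
    using k(1) m by (auto simp: prv_def nxt_def split: if_splits)
  have adj: "head G (p ! prv i) \<rightarrow>\<^bsub>G\<^esub> head G (p ! i)" if "i < m" for i
  proof -
    have "p ! i \<in> arcs G" using that arcs by (auto simp: m_def)
    then show ?thesis
      using tail_prv[OF that] by (metis in_arcs_imp_in_arcs_ends)
  qed
  have a: "head G (p ! k) \<rightarrow>\<^bsub>G\<^esub> head G (p ! prv k)"
    using adj[OF k(1)] by (rule graph_symmetric)
  have b: "head G (p ! k) \<rightarrow>\<^bsub>G\<^esub> head G (p ! nxt k)"
    using adj[OF idx(2)] idx(4) by simp
  have "head G (p ! prv k) = head G (p ! nxt k)"
    by (rule lower_unique[OF a b])
      (use adj_height_neq[OF a] adj_height_neq[OF b] k(2) idx(1,2) in \<open>simp_all add: le_neq_implies_less\<close>)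
  then show False using inj idx by blast
qed

end

section \<open>Connected components\<close>

lemma connected_add_arc:
  assumes "wf_digraph C" "connected C" "tail C e \<in> verts C \<or> head C e \<in> verts C"
  shows "connected (pre_digraph.add_arc C e)"
proof -
  let ?H = "pre_digraph.add_arc C e"
  let ?R = "(arcs_ends ?H)\<^sup>s"
  have vH: "verts ?H = verts C \<union> {tail C e, head C e}"
    by (rule pre_digraph.verts_add_arc_conv)
  interpret H: wf_digraph ?H
    using assms(1) by (rule wf_digraph.wf_digraph_add_arc)
  have e: "(tail C e, head C e) \<in> ?R" "(head C e, tail C e) \<in> ?R"
    by (auto simp: symcl_def arcs_ends_conv pre_digraph.add_arc_def)
  have mono: "(u, v) \<in> rtrancl_on (verts ?H) ?R" if "u \<in> verts C" "v \<in> verts C" for u v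
  proof -
    have "(u, v) \<in> rtrancl_on (verts C) ((arcs_ends C)\<^sup>s)"
      using assms(2) that by (simp add: connected_conv)
    then show ?thesis
      by (rule rtrancl_on_mono[rotated 2]) (auto simp: vH symcl_def arcs_ends_conv pre_digraph.add_arc_def)
  qed
  \<comment> \<open>An end of \<open>e\<close> inside \<open>C\<close> serves as a hub: old vertices
    reach it within \<open>C\<close>, a new one along \<open>e\<close>.\<close>
  obtain w where w: "w \<in> {tail C e, head C e}" "w \<in> verts C" using assms(3) by blast
  have to_w: "(u, w) \<in> rtrancl_on (verts ?H) ?R \<and> (w, u) \<in> rtrancl_on (verts ?H) ?R"
    if "u \<in> verts ?H" for u
  proof (cases "u \<in> verts C")
    case True
    then show ?thesis using mono w by blast
  next
    case False
    then have "u \<in> {tail C e, head C e}" using that vH by blast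
    then have "u = w \<or> ((u, w) \<in> ?R \<and> (w, u) \<in> ?R)"
      using w(1) e by blast
    moreover have "w \<in> verts ?H" using w vH by blast
    ultimately show ?thesis
      using that by (blast intro: rtrancl_on_into_rtrancl_on)
  qed
  show ?thesis
    unfolding connected_conv
    using to_w vH by (blast intro: rtrancl_on_trans)
qed

text \<open>Adding \<open>e\<close> to \<open>C\<close> gives a connected subgraph of
  \<open>G\<close>, which by maximality is \<open>C\<close> itself. So vertices of a component keep
  all their neighbours in \<open>G\<close>.\<close>

lemma connected_component_closed:
  assumes "connected_component G C" "e \<in> arcs G" "tail G e \<in> verts C \<or> head G e \<in> verts C"
  shows "e \<in> arcs C"
proof -
  have max: "subgraph C G" "connected C"
    "\<And>H. subgraph C H \<Longrightarrow> subgraph H G \<Longrightarrow> connected H \<Longrightarrow> H = C"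
    using assms(1) by (auto simp: connected_component_def pre_digraph.max_subgraph_def)
  from max(1) have C: "wf_digraph C" "wf_digraph G" "verts C \<subseteq> verts G" "arcs C \<subseteq> arcs G"
    "tail G = tail C" "head G = head C"
    by (auto simp: subgraph_def compatible_def)
  let ?H = "pre_digraph.add_arc C e"
  have wf: "wf_digraph ?H"
    using C(1) by (rule wf_digraph.wf_digraph_add_arc)
  have "subgraph C ?H"
    using C(1) wf by (auto simp: subgraph_def compatible_def pre_digraph.add_arc_def)
  moreover have "subgraph ?H G"
    using C wf assms(2) wf_digraph.wellformed[OF C(2) assms(2)]
    by (auto simp: subgraph_def compatible_def pre_digraph.add_arc_def)
  moreover have "connected ?H"
    using connected_add_arc[OF C(1) max(2)] assms(3) C(5,6) by simp
  ultimately have "?H = C" by (rule max(3))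
  then show ?thesis
    by (metis insertI1 pre_digraph.arcs_add_arc)
qed

section \<open>The quadratic equation\<close>

lemma sum_less_pairs_Suc:
  fixes f :: "nat \<Rightarrow> nat \<Rightarrow> 'a::comm_monoid_add"
  shows "(\<Sum>(i, j) \<in> {(i, j). i < j \<and> j < Suc n}. f i j) =
    (\<Sum>(i, j) \<in> {(i, j). i < j \<and> j < n}. f i j) + (\<Sum>i<n. f i n)"
proof -
  have split: "{(i, j). i < j \<and> j < Suc n} = {(i, j). i < j \<and> j < n} \<union> (\<lambda>i. (i, n)) ` {..<n}"
    by (auto simp: less_Suc_eq)
  have "finite {(i, j). i < j \<and> j < n}"
    by (rule finite_subset[of _ "{..<n} \<times> {..<n}"]) auto
  then show ?thesis
    unfolding split by (subst sum.union_disjoint) (auto simp: sum.reindex inj_on_def)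
qed

lemma sum_square_eq_pairs:
  fixes f :: "nat \<Rightarrow> 'a::comm_ring_1"
  shows "(\<Sum>i<n. f i)\<^sup>2 = (\<Sum>i<n. (f i)\<^sup>2) + 2 * (\<Sum>(i, j) \<in> {(i, j). i < j \<and> j < n}. f i * f j)"
proof (induction n)
  case 0
  show ?case by simp
next
  case (Suc n)
  have "(\<Sum>i<Suc n. f i)\<^sup>2 = (\<Sum>i<n. f i)\<^sup>2 + (f n)\<^sup>2 + 2 * (\<Sum>i<n. f i * f n)"
    by (simp add: power2_sum mult.assoc flip: sum_distrib_right)
  then show ?case
    using Suc.IH by (simp add: sum_less_pairs_Suc distrib_left)
qed

lemma solution_set_quadratic:
  assumes "A \<in> solution_set n"
  shows "2 * (\<Sum>x\<in>#A. x\<^sup>2) = sum_mset A * (sum_mset A + 1)"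
proof -
  from assms obtain xs where xs: "solves n xs" "A = mset xs"
    by (auto simp: solution_set_def)
  then have len: "length xs = n" by (simp add: solves_def)
  have s: "sum_mset A = (\<Sum>i<n. xs ! i)"
    by (simp add: xs(2) sum_mset_sum_list sum_list_sum_nth len atLeast0LessThan)
  have q: "(\<Sum>x\<in>#A. x\<^sup>2) = (\<Sum>i<n. (xs ! i)\<^sup>2)"
    by (simp add: xs(2) sum_mset_sum_list sum_list_sum_nth len atLeast0LessThan flip: mset_map)
  show ?thesis
    using xs(1) sum_square_eq_pairs[of "\<lambda>i. xs ! i" n]
    unfolding solves_def s q distrib_left by (simp add: power2_eq_square)
qed

lemma adjacent_sym:
  assumes "adjacent n A B"
  shows "adjacent n B A"
proof -
  from assms obtain xs ys where "length xs = n" "length ys = n" "mset xs = A" "mset ys = B"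
    and "\<exists>!i. i < n \<and> xs ! i \<noteq> ys ! i"
    unfolding adjacent_def by blast
  moreover have "(i < n \<and> ys ! i \<noteq> xs ! i) \<longleftrightarrow> (i < n \<and> xs ! i \<noteq> ys ! i)" for i
    by auto
  ultimately show ?thesis
    unfolding adjacent_def by (intro exI[of _ ys] exI[of _ xs]) simp
qed

text \<open>Removing the differing entry from both lists leaves the common multiset
  \<open>M\<close>, so orderings disappear from the argument.\<close>

lemma adjacentE:
  assumes "adjacent n A B"
  obtains x y M where "x \<noteq> y" "A = add_mset x M" "B = add_mset y M"
proof -
  from assms obtain xs ys where *: "length xs = n" "length ys = n" "mset xs = A" "mset ys = B"
    and ex1: "\<exists>!i. i < n \<and> xs ! i \<noteq> ys ! i"
    unfolding adjacent_def by blast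
  from ex1 obtain i where i: "i < n \<and> xs ! i \<noteq> ys ! i"
    and others: "\<forall>j. j < n \<and> xs ! j \<noteq> ys ! j \<longrightarrow> j = i"
    by (rule ex1E)
  have "ys = xs[i := ys ! i]"
  proof (rule nth_equalityI)
    show "length ys = length (xs[i := ys ! i])" using * by simp
    fix j assume "j < length ys"
    then show "ys ! j = xs[i := ys ! i] ! j"
      using *(1,2) others by (cases "j = i") auto
  qed
  then have "B = add_mset (ys ! i) (A - {#xs ! i#})"
    using * i mset_update[of i xs "ys ! i"] by simp
  moreover have "A = add_mset (xs ! i) (A - {#xs ! i#})"
    using * i by (auto simp: in_multiset_in_set)
  ultimately show thesis using that i by blast
qed

text \<open>With \<open>M\<close> fixed, the equation is quadratic in the remaining entry, and its
  roots add up to \<open>2 * sum_mset M + 1\<close>.\<close>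

lemma vieta_root:
  fixes x y :: int
  assumes "add_mset x M \<in> solution_set n" "add_mset y M \<in> solution_set n" "x \<noteq> y"
  shows "y = 2 * sum_mset M + 1 - x"
proof -
  have "(x - y) * (x + y - 2 * sum_mset M - 1) = 0"
    using solution_set_quadratic[OF assms(1)] solution_set_quadratic[OF assms(2)]
    by (simp add: algebra_simps power2_eq_square)
  then show ?thesis using assms(3) by simp
qed

lemma adjacent_height_neq:
  assumes "A \<in> solution_set n" "B \<in> solution_set n" "adjacent n A B"
  shows "height A \<noteq> height B"
proof -
  obtain x y M where *: "x \<noteq> y" "A = add_mset x M" "B = add_mset y M"
    using assms(3) by (rule adjacentE)
  have "y = 2 * sum_mset M + 1 - x"
    using vieta_root[of x M n y] assms(1,2) * by simp
  \<comment> \<open>With \<open>t = sum_mset M\<close>, the quantities \<open>1 + sum_mset A\<close>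
    and \<open>1 + sum_mset B\<close> add up to \<open>4 * t + 3\<close>. This is odd, so they are
    neither equal nor opposite.\<close>
  then show ?thesis
    unfolding height_def *(2,3) abs_eq_iff sum_mset.add_mset by presburger
qed

text \<open>The squares of the two sides differ by \<open>(4 * t + 3) * (2 * x - 2 * t - 1)\<close>,
  so the sign of \<open>4 * t + 3\<close> decides on which side of \<open>t\<close> the entry
  \<open>x\<close> lies.\<close>

lemma lower_root_bound:
  fixes x t :: int
  assumes "\<bar>1 + ((2 * t + 1 - x) + t)\<bar> < \<bar>1 + (x + t)\<bar>"
  shows "x + t \<ge> 1 \<and> 2 * x \<ge> x + t + 1 \<or> x + t \<le> - 2 \<and> 2 * x \<le> x + t"
proof (cases "t \<ge> 0")
  case True
  then have "x \<ge> t + 1" using assms by linarith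
  with True show ?thesis by linarith
next
  case False
  then have "x \<le> t" using assms by linarith
  with False show ?thesis by linarith
qed

text \<open>The left-hand side is at least \<open>(s + 1)\<^sup>2\<close> for positive
  \<open>s\<close> and at least \<open>s\<^sup>2\<close> for negative \<open>s\<close>; each exceeds
  \<open>s * (s + 1)\<close> for that sign.\<close>

lemma no_two_large:
  fixes x y s :: int
  assumes "s \<ge> 1 \<and> 2 * x \<ge> s + 1 \<or> s \<le> - 2 \<and> 2 * x \<le> s"
    and "s \<ge> 1 \<and> 2 * y \<ge> s + 1 \<or> s \<le> - 2 \<and> 2 * y \<le> s"
  shows "2 * (x\<^sup>2 + y\<^sup>2) > s * (s + 1)"
proof (cases "s \<ge> 1")
  case True
  have "(s + 1)\<^sup>2 \<le> (2 * x)\<^sup>2" "(s + 1)\<^sup>2 \<le> (2 * y)\<^sup>2"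
    by (rule power_mono; use True assms in linarith)+
  then show ?thesis using True by (simp add: power2_eq_square algebra_simps)
next
  case False
  have "(- s)\<^sup>2 \<le> (- 2 * x)\<^sup>2" "(- s)\<^sup>2 \<le> (- 2 * y)\<^sup>2"
    by (rule power_mono; use False assms in linarith)+
  moreover have "s < 0" using False assms by linarith
  ultimately show ?thesis by (simp add: power2_eq_square algebra_simps)
qed

lemma lower_neighbour_unique:
  assumes "A \<in> solution_set n" "B \<in> solution_set n" "B' \<in> solution_set n"
    and "adjacent n A B" "adjacent n A B'" "height B < height A" "height B' < height A"
  shows "B = B'"
proof -
  obtain x y M where *: "x \<noteq> y" "A = add_mset x M" "B = add_mset y M"
    using assms(4) by (rule adjacentE)
  obtain x' y' M' where alt: "x' \<noteq> y'" "A = add_mset x' M'" "B' = add_mset y' M'"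
    using assms(5) by (rule adjacentE)
  have y: "y = 2 * sum_mset M + 1 - x" "y' = 2 * sum_mset M' + 1 - x'"
    using vieta_root[of x M n y] vieta_root[of x' M' n y'] assms(1-3) * alt by simp_all
  show ?thesis
  proof (cases "x = x'")
    case True
    \<comment> \<open>Equal removed entries leave equal remainders, and Vieta's relation then fixes
      the new entry.\<close>
    then show ?thesis using * alt y by simp
  next
    case False
    \<comment> \<open>Distinct removed entries are two separate members of \<open>A\<close>. Both
      are large, and the squares over the rest \<open>N\<close> only enlarge the sum.\<close>
    then obtain N where N: "M = add_mset x' N"
      using *(2) alt(2) by (metis add_eq_conv_ex)
    let ?s = "sum_mset A"
    have "?s \<ge> 1 \<and> 2 * x \<ge> ?s + 1 \<or> ?s \<le> - 2 \<and> 2 * x \<le> ?s"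
      using lower_root_bound[of "sum_mset M" x] assms(6) y unfolding height_def * by simp
    moreover have "?s \<ge> 1 \<and> 2 * x' \<ge> ?s + 1 \<or> ?s \<le> - 2 \<and> 2 * x' \<le> ?s"
      using lower_root_bound[of "sum_mset M'" x'] assms(7) y unfolding height_def alt by simp
    ultimately have "2 * (x\<^sup>2 + x'\<^sup>2) > ?s * (?s + 1)"
      by (rule no_two_large)
    moreover have "(\<Sum>z\<in>#A. z\<^sup>2) = x\<^sup>2 + x'\<^sup>2 + (\<Sum>z\<in>#N. z\<^sup>2)"
      by (simp add: *(2) N)
    moreover have "(\<Sum>z\<in>#N. z\<^sup>2) \<ge> 0"
      by (induction N) simp_all
    ultimately have "?s * (?s + 1) < 2 * (\<Sum>z\<in>#A. z\<^sup>2)"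
      by simp
    then show ?thesis
      using solution_set_quadratic[OF assms(1)] by simp
  qed
qed

section \<open>The solution graph\<close>

lemma solution_graph_simps:
  "verts (solution_graph n) = solution_set n"
  "arcs (solution_graph n) =
    {(A, B). A \<in> solution_set n \<and> B \<in> solution_set n \<and> adjacent n A B}"
  "tail (solution_graph n) = fst"
  "head (solution_graph n) = snd"
  by (simp_all add: solution_graph_def)

theorem theorem4p4:
  fixes n :: nat and C :: "(int multiset, int multiset \<times> int multiset) pre_digraph"
  assumes "n \<ge> 2"
    and "connected_component (solution_graph n) C"
  shows "undirected_tree C
    \<and> (\<exists>!r. r \<in> verts C \<and> is_root n r)
    \<and> (\<forall>r \<in> verts C. is_root n r \<longrightarrow> (\<forall>v \<in> verts C. v \<noteq> r \<longrightarrow> height r < height v))"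
proof -
  let ?G = "solution_graph n"
  have sub: "subgraph C ?G" and conn: "connected C"
    using assms(2) by (auto simp: connected_component_def pre_digraph.max_subgraph_def)
  then have C: "wf_digraph C" "verts C \<subseteq> verts ?G" "arcs C \<subseteq> arcs ?G"
    "tail C = fst" "head C = snd"
    by (auto simp: subgraph_def compatible_def solution_graph_simps)
  have closed: "e \<in> arcs C" if "e \<in> arcs ?G" "fst e \<in> verts C \<or> snd e \<in> verts C" for e
    using connected_component_closed[OF assms(2) that(1)] that(2) by (simp add: solution_graph_simps)
  have ends_G: "A \<rightarrow>\<^bsub>?G\<^esub> B \<longleftrightarrow> (A, B) \<in> arcs ?G" for A B
    by (auto simp: arcs_ends_conv solution_graph_simps)
  have ends_C: "A \<rightarrow>\<^bsub>C\<^esub> B \<longleftrightarrow> (A, B) \<in> arcs C" for A B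
    using C(4,5) by (auto simp: arcs_ends_conv)
  have adjD: "A \<in> solution_set n" "B \<in> solution_set n" "adjacent n A B" if "A \<rightarrow>\<^bsub>C\<^esub> B" for A B
    using that C(3) by (auto simp: ends_C solution_graph_simps)
  have nat_height: "nat (height A) < nat (height B) \<longleftrightarrow> height A < height B" for A B
    by (auto simp: height_def)
  interpret C: wf_digraph C by (rule C(1))
  interpret C: unique_descent_graph C "\<lambda>A. nat (height A)"
  proof
    \<comment> \<open>The reversed arc is an arc of the full graph touching \<open>C\<close>, so
      \<open>closed\<close> puts it into \<open>C\<close>.\<close>
    have "(B, A) \<in> arcs C" if "(A, B) \<in> arcs C" for A B
      using that C(3) C.wellformed[OF that] C(4,5)
      by (intro closed) (auto simp: solution_graph_simps intro: adjacent_sym)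
    then show "symmetric C"
      by (auto simp: symmetric_def sym_def ends_C)
  next
    fix u v assume "u \<rightarrow>\<^bsub>C\<^esub> v"
    then show "nat (height u) \<noteq> nat (height v)"
      using adjacent_height_neq[OF adjD] nat_height by (metis linorder_neq_iff)
  next
    fix u v w
    assume "u \<rightarrow>\<^bsub>C\<^esub> v" "u \<rightarrow>\<^bsub>C\<^esub> w" "nat (height v) < nat (height u)" "nat (height w) < nat (height u)"
    then show "v = w"
      using lower_neighbour_unique adjD unfolding nat_height by blast
  qed
  \<comment> \<open>\<open>is_root\<close> looks at neighbours in the whole graph; by
    \<open>closed\<close> these are the neighbours within \<open>C\<close>.\<close>
  have root: "r \<in> verts C \<and> is_root n r \<longleftrightarrow> C.local_min r" for r
  proof -
    have "r \<rightarrow>\<^bsub>?G\<^esub> B \<longleftrightarrow> r \<rightarrow>\<^bsub>C\<^esub> B" if "r \<in> verts C" for B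
      using closed[of "(r, B)"] that C(3) by (auto simp: ends_G ends_C)
    then show ?thesis
      using C(2) unfolding is_root_def C.local_min_def nat_height by blast
  qed
  have "undirected_tree C"
    unfolding undirected_tree_def
  proof (intro conjI)
    \<comment> \<open>A loop would join two ends of equal height.\<close>
    show "loopfree_digraph C"
      using C.adj_height_neq C(4,5) by unfold_locales (fastforce simp: ends_C)
    show "nomulti_digraph C"
      using C(4,5) by unfold_locales (auto simp: arc_to_ends_def)
    show "sym_digraph C" by unfold_locales
    show "connected C" by (rule conn)
    show "\<not> (\<exists>p. C.cycle p \<and> length p \<ge> 3)"
      using C.short_cycle by force
  qed
  moreover have "\<exists>!r. r \<in> verts C \<and> is_root n r"
    unfolding root by (rule C.ex1_local_min[OF conn])
  moreover have "height r < height v"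
    if "r \<in> verts C" "is_root n r" "v \<in> verts C" "v \<noteq> r" for r v
    using C.local_min_strict[OF conn _ that(3,4)] root that(1,2) unfolding nat_height by blast
  ultimately show ?thesis by blast
qed

end
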